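(* For $n,m\ge 0$ let $r_{n,m}$ be the number of Rota-Baxter words in $R$ of degree $n$ and arity $m$. Then, as formal power series in $z,t$, $$\sum_{n=0}^\infty\sum_{m=0}^\infty r_{n,m}z^nt^m=\frac{1-\sqrt{1-4zt-4zt^2}}{2tz}.$$
   Context: Words are finite strings over the three symbols $x,\lfloor,\rfloor$. Let $R$ be the set consisting of the empty word $\emptyset$ together with all nonempty strings $w$ such that: (i) $w$ has equally many $\lfloor$ and $\rfloor$, and every prefix of $w$ has at least as many $\lfloor$ as $\rfloor$ (so brackets are balanced and matched into pairs in the usual way); (ii) no two $x$'s are adjacent in $w$; (iii) neither $\rfloor\lfloor$ nor $\lfloor\rfloor$ occurs as a substring of $w$; (iv) no two matched pairs of brackets are immediately nested, i.e. no substring $\lfloor\lfloor w'\rfloor\rfloor$ occurs in which the first $\lfloor$ is matched with the last $\rfloor$ and the second $\lfloor$ with the second-to-last $\rfloor$. Elements of $R$ are called Rota-Baxter words. The degree of a word is its number of matched pairs of brackets; its arity is the number of $x$'s in it. The empty word has degree $0$ and arity $0$. The square root is the formal power series with constant term $1$. *)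

theory Defs
  imports
    "HOL-Library.Sublist"
    "HOL-Computational_Algebra.Formal_Power_Series"
    "HOL-Computational_Algebra.Polynomial_Factorial"
begin

datatype letter = X | LB | RB

type_synonym word = "letter list"

definition balanced :: "word \<Rightarrow> bool" where
  "balanced w \<longleftrightarrow>
     count_list w LB = count_list w RB \<and>
     (\<forall>p. prefix p w \<longrightarrow> count_list p RB \<le> count_list p LB)"

text \<open>
  Positions are counted from 0. A left bracket at position \<open>i\<close> and a right bracket at
  position \<open>j\<close> are matched iff the factor strictly between them is balanced.
\<close>

definition matched :: "word \<Rightarrow> nat \<Rightarrow> nat \<Rightarrow> bool" where
  "matched w i j \<longleftrightarrow>
     i < j \<and> j < length w \<and> w ! i = LB \<and> w ! j = RB \<and>
     balanced (take (j - Suc i) (drop (Suc i) w))"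

definition RB_words :: "word set" where
  "RB_words = {[]} \<union> {w. w \<noteq> [] \<and>
     balanced w \<and>
     \<not> sublist [X, X] w \<and>
     \<not> sublist [RB, LB] w \<and> \<not> sublist [LB, RB] w \<and>
     \<not> (\<exists>i j. matched w i j \<and> matched w (i + 1) (j - 1))}"

definition degree_word :: "word \<Rightarrow> nat" where
  "degree_word w = card {(i, j). matched w i j}"

definition arity :: "word \<Rightarrow> nat" where
  "arity w = count_list w X"

text \<open>
  A word of \<open>RB_words\<close> of degree \<open>n\<close> and arity \<open>m\<close> has length \<open>2 * n + m\<close>, so the
  cardinality below is that of a finite set.
\<close>

definition r :: "nat \<Rightarrow> nat \<Rightarrow> nat" where
  "r n m = card {w \<in> RB_words. degree_word w = n \<and> arity w = m}"

text \<open>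
  Bivariate power series in \<open>z\<close> and \<open>t\<close> are power series in \<open>z\<close> whose coefficients are
  power series in \<open>t\<close>: the coefficient of \<open>z^n * t^m\<close> in \<open>F\<close> is \<open>fps_nth (fps_nth F n) m\<close>.
\<close>

type_synonym 'a fps2 = "'a fps fps"

definition var_z :: "rat fps2" where
  "var_z = fps_X"

definition var_t :: "rat fps2" where
  "var_t = fps_const fps_X"

definition rb_series :: "rat fps2" where
  "rb_series = Abs_fps (\<lambda>n. Abs_fps (\<lambda>m. of_nat (r n m)))"

text \<open>
  The library's \<open>fps_radical\<close> needs coefficients in a field, so it does not apply to
  series over \<open>rat fps\<close>.
\<close>

definition fps2_sqrt :: "rat fps2 \<Rightarrow> rat fps2" where
  "fps2_sqrt A = (THE S. S ^ 2 = A \<and> fps_nth (fps_nth S 0) 0 = 1)"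

lemma fps2_sqrt_eqI:
  assumes "S ^ 2 = A" and "fps_nth (fps_nth S 0) 0 = 1"
  shows "fps2_sqrt A = S"
  unfolding fps2_sqrt_def
proof (rule the_equality)
  fix T assume T: "T ^ 2 = A \<and> fps_nth (fps_nth T 0) 0 = 1"
  with assms(1) have "T ^ 2 = S ^ 2"
    by simp
  then have "T = S \<or> T = - S"
    by (simp only: power2_eq_iff)
  with T assms(2) show "T = S"
    by auto
qed (use assms in simp)

end

theory Submission
  imports Defs
begin

text \<open>
  Let \<open>R\<close> be the generating function of the Rota-Baxter words. The formula says that
  \<open>1 - 2tzR\<close> is a square root of \<open>1 - 4zt - 4zt\<^sup>2\<close>, which is the quadratic equation
  \<open>tzR\<^sup>2 = R - 1 - t\<close> after completing the square; the constant term \<open>1\<close> of \<open>1 - 2tzR\<close>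
  selects the root.

  The quadratic equation comes from an unambiguous grammar with two auxiliary families: the
  Rota-Baxter words that do not start with \<open>X\<close> (series \<open>Q\<close>), and the nonempty ones that are
  not a single bracketed word (series \<open>C\<close>), which are exactly the words that may stand inside a
  pair of brackets.

  \<^item> Prefixing \<open>X\<close> is possible exactly for words not starting with \<open>X\<close>, so \<open>R = (1 + t)Q\<close>
    (\<open>RB_words_split_leading_X\<close>).

  \<^item> A nonempty word is either counted by \<open>C\<close> or is a bracketed word counted by \<open>C\<close>, so
    \<open>R = 1 + (1 + z)C\<close> (\<open>RB_words_split_enclosed\<close>).

  \<^item> A nonempty word not starting with \<open>X\<close> is a bracketed word counted by \<open>C\<close>, followed by
    nothing or by \<open>X\<close> and a word not starting with \<open>X\<close>, so \<open>Q = 1 + zC(1 + tQ)\<close>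
    (\<open>nonX_words_split_bracket\<close>).

  Eliminating \<open>C\<close> gives \<open>(1 + z)(Q - 1) = z((1 + t)Q - 1)(1 + tQ)\<close>. The terms \<open>z(Q - 1)\<close>
  cancel and leave \<open>Q - 1 = zt(1 + t)Q\<^sup>2\<close>, which is the quadratic equation for
  \<open>R\<close> divided by \<open>1 + t\<close>.

  Write \<open>[v]\<close> for a bracketed word, \<open>enclose v\<close> below. The combinatorial content is that this
  grammar describes the words locally: for balanced \<open>v\<close> and \<open>u\<close>, the forbidden
  patterns of \<open>[v]u\<close> are those of \<open>v\<close>, those of \<open>u\<close>, and a few at the seams
  (\<open>enclose_append_in_RB_words_iff\<close>). The decomposition is unique because the
  bracket closing the first letter is found at the first point where the remaining word descends
  below its starting level (\<open>first_descent\<close>, \<open>descent_unique\<close>).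
\<close>

section \<open>Balanced words and their factorisations\<close>

definition excess :: "word \<Rightarrow> int" where
  "excess w = int (count_list w LB) - int (count_list w RB)"

lemma excess_Nil [simp]: "excess [] = 0"
  by (simp add: excess_def)

lemma excess_Cons [simp]:
  "excess (l # w) = (case l of X \<Rightarrow> 0 | LB \<Rightarrow> 1 | RB \<Rightarrow> - 1) + excess w"
  by (simp add: excess_def split: letter.split)

lemma excess_append [simp]: "excess (u @ v) = excess u + excess v"
  by (simp add: excess_def)

lemma balanced_iff_excess:
  "balanced w \<longleftrightarrow> excess w = 0 \<and> (\<forall>p s. w = p @ s \<longrightarrow> 0 \<le> excess p)"
  by (auto simp: balanced_def excess_def prefix_def)

lemma balanced_excess: "balanced w \<Longrightarrow> excess w = 0"
  by (simp add: balanced_iff_excess)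

lemma balanced_prefix_excess: "balanced (p @ s) \<Longrightarrow> 0 \<le> excess p"
  by (auto simp: balanced_iff_excess)

lemma balanced_suffix_excess: "balanced (p @ s) \<Longrightarrow> excess s \<le> 0"
  using balanced_excess[of "p @ s"] balanced_prefix_excess[of p s] by simp

lemma balanced_Nil [simp]: "balanced []"
  by (simp add: balanced_iff_excess)

lemma balanced_append: "balanced u \<Longrightarrow> balanced v \<Longrightarrow> balanced (u @ v)"
  by (auto simp: balanced_iff_excess append_eq_append_conv2)

lemma balanced_appendD: "balanced (u @ v) \<Longrightarrow> balanced u \<Longrightarrow> balanced v"
proof (unfold balanced_iff_excess[of v], intro conjI allI impI)
  assume uv: "balanced (u @ v)" and u: "balanced u"
  show "excess v = 0"
    using balanced_excess[OF uv] balanced_excess[OF u] by simp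
  fix p s assume "v = p @ s"
  then show "0 \<le> excess p"
    using balanced_prefix_excess[of "u @ p" s] uv balanced_excess[OF u] by simp
qed

lemma balanced_Cons_X [simp]: "balanced (X # w) \<longleftrightarrow> balanced w"
  using balanced_append[of "[X]" w] balanced_appendD[of "[X]" w]
  by (auto simp: balanced_iff_excess[of "[X]"] Cons_eq_append_conv)

lemma not_balanced_Cons_RB [simp]: "\<not> balanced (RB # w)"
  using balanced_prefix_excess[of "[RB]" w] by auto

lemma not_balanced_snoc_LB [simp]: "\<not> balanced (w @ [LB])"
  using balanced_suffix_excess[of w "[LB]"] by auto

definition enclose :: "word \<Rightarrow> word" where
  "enclose v = LB # v @ [RB]"

lemma excess_enclose [simp]: "excess (enclose v) = excess v"
  by (simp add: enclose_def)

lemma enclose_inject [simp]: "enclose v = enclose v' \<longleftrightarrow> v = v'"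
  by (simp add: enclose_def)

lemma enclose_not_Nil [simp]: "enclose v \<noteq> []" "[] \<noteq> enclose v"
  by (simp_all add: enclose_def)

text \<open>
  The opening bracket lifts everything up to the final letter by one level. Hence no balanced
  word is a nonempty proper prefix of a bracketed word.
\<close>

lemma enclose_proper_prefix_excess:
  assumes "balanced v" "enclose v = p @ s" "p \<noteq> []" "s \<noteq> []"
  shows "0 < excess p"
proof -
  from assms(2,3) obtain p' where p: "p = LB # p'" "v @ [RB] = p' @ s"
    by (auto simp: enclose_def Cons_eq_append_conv)
  with assms(4) obtain s' where "v = p' @ s'"
    by (cases s rule: rev_cases) auto
  with assms(1) p(1) show ?thesis
    using balanced_prefix_excess[of p' s'] by simp
qed

lemma balanced_enclose [simp]: "balanced v \<Longrightarrow> balanced (enclose v)"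
  unfolding balanced_iff_excess[of "enclose v"]
proof (intro conjI allI impI)
  assume v: "balanced v"
  then show "excess (enclose v) = 0"
    by (simp add: balanced_excess)
  fix p s assume ps: "enclose v = p @ s"
  show "0 \<le> excess p"
  proof (cases "p = [] \<or> s = []")
    case True
    then show ?thesis
      using ps balanced_excess[OF v] excess_enclose[of v] by auto
  qed (use enclose_proper_prefix_excess[OF v ps] in auto)
qed

text \<open>
  Reading \<open>c\<close> as a walk that ends below its start, the letter at which it first leaves the upper
  half-plane must be \<open>RB\<close>, and the part before it is balanced. Applied to what follows an
  opening bracket, this finds the matching closing bracket.
\<close>

lemma first_descent:
  assumes "excess c < 0"
  shows "\<exists>v u. balanced v \<and> c = v @ RB # u"
  using assms
proof (induction c rule: length_induct)
  case (1 c)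
  show ?case
  proof (cases "\<exists>p s. c = p @ s \<and> s \<noteq> [] \<and> excess p < 0")
    case True
    then obtain p s where p: "c = p @ s" "s \<noteq> []" "excess p < 0"
      by blast
    from p(1,2) have "length p < length c"
      by simp
    with 1(1) p(3) obtain v u where "balanced v" "p = v @ RB # u"
      by blast
    with p(1) show ?thesis
      by auto
  next
    case False
    from 1(2) obtain c' l where c: "c = c' @ [l]"
      by (cases c rule: rev_cases) auto
    from False have nonneg: "0 \<le> excess p" if "c' = p @ s" for p s
      using that c by (metis append.assoc append_is_Nil_conv not_less not_Cons_self2)
    have "0 \<le> excess c'"
      by (rule nonneg[of _ "[]"]) simp
    with 1(2) c have "l = RB" "excess c' = 0"
      by (cases l; simp)+
    with nonneg c show ?thesis
      by (auto simp: balanced_iff_excess)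
  qed
qed

text \<open>
  If one of the two balanced parts were longer, it would have the other one followed by \<open>RB\<close> as
  a prefix, and that prefix has excess \<open>-1\<close>.
\<close>

lemma descent_unique:
  assumes "balanced v" "balanced v'" "v @ RB # u = v' @ RB # u'"
  shows "v = v' \<and> u = u'"
proof -
  have not_prefix: "\<not> balanced (w @ RB # s)" if "balanced w" for w s
    using that balanced_prefix_excess[of "w @ [RB]" s] balanced_excess[of w] by auto
  from assms(3) consider us where "v = v' @ us" "us @ RB # u = RB # u'"
    | us where "v' = v @ us" "us @ RB # u' = RB # u"
    by (auto simp: append_eq_append_conv2)
  then show ?thesis
  proof cases
    case 1
    with assms(1,2) not_prefix[of v'] show ?thesis
      by (cases us) auto
  next
    case 2
    with assms(1,2) not_prefix[of v] show ?thesis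
      by (cases us) auto
  qed
qed

lemma enclose_append_inject:
  assumes "balanced v" "balanced v'" "enclose v @ u = enclose v' @ u'"
  shows "v = v' \<and> u = u'"
  using descent_unique[OF assms(1,2)] assms(3) by (simp add: enclose_def)

text \<open>
  The first-return decomposition of a balanced word.
\<close>

lemma balanced_Cons_LB:
  assumes "balanced (LB # w)"
  obtains v u where "balanced v" "balanced u" "LB # w = enclose v @ u"
proof -
  have "excess w < 0"
    using balanced_excess[OF assms] by simp
  then obtain v u where vu: "balanced v" "w = v @ RB # u"
    using first_descent by blast
  then have eq: "LB # w = enclose v @ u"
    by (simp add: enclose_def)
  with assms vu(1) have "balanced u"
    by (metis balanced_appendD balanced_enclose)
  with vu eq that show ?thesis
    by blast
qed

section \<open>Matched pairs\<close>

text \<open>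
  Replaces positions by factorisations, in which the structure of brackets can be manipulated
  without index arithmetic.
\<close>

lemma matched_iff_factor:
  "matched w i j \<longleftrightarrow>
    (\<exists>a v c. balanced v \<and> w = a @ enclose v @ c \<and> i = length a \<and> j = Suc (i + length v))"
proof
  assume m: "matched w i j"
  define v where "v = take (j - Suc i) (drop (Suc i) w)"
  from m have ij: "i < j" "j < length w" "w ! i = LB" "w ! j = RB" and v: "balanced v"
    by (auto simp: matched_def v_def)
  have "w = take i w @ w ! i # drop (Suc i) w"
    using ij by (intro id_take_nth_drop) simp
  also have "drop (Suc i) w = v @ drop j w"
    using ij append_take_drop_id[of "j - Suc i" "drop (Suc i) w"] by (simp add: v_def)
  also have "drop j w = w ! j # drop (Suc j) w"
    using ij(2) by (rule Cons_nth_drop_Suc[symmetric])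
  finally have "w = take i w @ enclose v @ drop (Suc j) w"
    using ij by (simp add: enclose_def)
  moreover have "i = length (take i w)" "j = Suc (i + length v)"
    using ij by (auto simp: v_def)
  ultimately show "\<exists>a v c. balanced v \<and> w = a @ enclose v @ c \<and> i = length a \<and>
      j = Suc (i + length v)"
    using v by blast
next
  assume "\<exists>a v c. balanced v \<and> w = a @ enclose v @ c \<and> i = length a \<and> j = Suc (i + length v)"
  then show "matched w i j"
    by (auto simp: matched_def enclose_def nth_append)
qed

text \<open>
  Every opening bracket of a balanced word has exactly one partner: the suffix after it has
  negative excess, so \<open>first_descent\<close> provides one, and \<open>descent_unique\<close> excludes a second.
  Counting pairs therefore amounts to counting \<open>LB\<close>, a quantity that is additive under
  concatenation.
\<close>

lemma degree_word_balanced: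
  assumes "balanced w"
  shows "degree_word w = count_list w LB"
proof -
  have inj: "inj_on fst {(i, j). matched w i j}"
  proof (rule inj_onI)
    fix p q assume "p \<in> {(i, j). matched w i j}" "q \<in> {(i, j). matched w i j}" "fst p = fst q"
    then obtain i j j' where ij: "p = (i, j)" "q = (i, j')" "matched w i j" "matched w i j'"
      by (cases p; cases q) auto
    then obtain a v c a' v' c' where
      v: "balanced v" "w = a @ enclose v @ c" "i = length a" "j = Suc (i + length v)" and
      v': "balanced v'" "w = a' @ enclose v' @ c'" "i = length a'" "j' = Suc (i + length v')"
      unfolding matched_iff_factor by blast
    have "enclose v @ c = enclose v' @ c'"
      using v(2,3) v'(2,3) by (metis append_eq_append_conv)
    then have "v = v'"
      using enclose_append_inject v(1) v'(1) by blast
    then show "p = q"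
      using ij(1,2) v(4) v'(4) by simp
  qed
  have "fst ` {(i, j). matched w i j} = {i. i < length w \<and> w ! i = LB}" (is "?L = ?R")
  proof
    show "?L \<subseteq> ?R"
      by (auto simp: matched_def)
    show "?R \<subseteq> ?L"
    proof
      fix i assume "i \<in> ?R"
      then have i: "i < length w" "w ! i = LB"
        by auto
      define a c where "a = take i w" and "c = drop (Suc i) w"
      have w: "w = a @ LB # c"
        using i id_take_nth_drop[of i w] by (simp add: a_def c_def)
      have "excess c < 0"
        using balanced_suffix_excess[of a "LB # c"] assms w by simp
      then obtain v u where "balanced v" "c = v @ RB # u"
        using first_descent by blast
      with w have "matched w (length a) (Suc (length a + length v))"
        unfolding matched_iff_factor by (auto simp: enclose_def)
      moreover have "length a = i"
        using i by (simp add: a_def)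
      ultimately show "i \<in> ?L"
        by force
    qed
  qed
  then have "degree_word w = card {i. i < length w \<and> w ! i = LB}"
    unfolding degree_word_def using card_image[OF inj] by simp
  also have "\<dots> = count_list w LB"
    by (simp add: count_list_eq_length_filter length_filter_conv_card eq_commute)
  finally show ?thesis .
qed

text \<open>
  Turns the last condition on Rota-Baxter words into the avoidance of a family of factors, like
  the other three.
\<close>

lemma nested_pair_iff_sublist:
  "(\<exists>i j. matched w i j \<and> matched w (i + 1) (j - 1)) \<longleftrightarrow>
    (\<exists>v. balanced v \<and> sublist (enclose (enclose v)) w)"
proof
  assume "\<exists>i j. matched w i j \<and> matched w (i + 1) (j - 1)"
  then obtain i j a v c a' v' c' where
    v: "balanced v" "w = a @ enclose v @ c" "i = length a" "j = Suc (i + length v)" and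
    v': "balanced v'" "w = a' @ enclose v' @ c'" "i + 1 = length a'"
      "j - 1 = Suc (i + 1 + length v')"
    unfolding matched_iff_factor by blast
  have "a' = take (i + 1) w"
    using v' by simp
  also have "\<dots> = a @ [LB]"
    using v by (simp add: enclose_def)
  finally have "a' = a @ [LB]" .
  with v v' have "v @ RB # c = enclose v' @ c'" "length v = length (enclose v')"
    by (auto simp: enclose_def)
  then have "v = enclose v'"
    by simp
  with v v' show "\<exists>v. balanced v \<and> sublist (enclose (enclose v)) w"
    by (auto simp: sublist_def)
next
  assume "\<exists>v. balanced v \<and> sublist (enclose (enclose v)) w"
  then obtain v a c where v: "balanced v" "w = a @ enclose (enclose v) @ c"
    by (auto simp: sublist_def)
  have "matched w (length a) (length a + length v + 3)"
    unfolding matched_iff_factor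
    by (rule exI[of _ a], rule exI[of _ "enclose v"], rule exI[of _ c])
       (use v in \<open>intro conjI balanced_enclose, simp_all add: enclose_def\<close>)
  moreover have "matched w (length a + 1) (length a + length v + 3 - 1)"
    unfolding matched_iff_factor
    by (rule exI[of _ "a @ [LB]"], rule exI[of _ v], rule exI[of _ "RB # c"])
       (use v in \<open>auto simp: enclose_def\<close>)
  ultimately show "\<exists>i j. matched w i j \<and> matched w (i + 1) (j - 1)"
    by blast
qed

section \<open>The grammar of Rota-Baxter words\<close>

text \<open>
  The empty word satisfies the conditions as well, so the case distinction in the definition
  disappears.
\<close>

lemma RB_words_iff:
  "w \<in> RB_words \<longleftrightarrow> balanced w \<and> \<not> sublist [X, X] w \<and> \<not> sublist [RB, LB] w \<and>
    \<not> sublist [LB, RB] w \<and> \<not> (\<exists>v. balanced v \<and> sublist (enclose (enclose v)) w)"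
  by (cases "w = []")
     (simp_all add: RB_words_def nested_pair_iff_sublist del: One_nat_def)

lemma Nil_in_RB_words [simp]: "[] \<in> RB_words"
  by (simp add: RB_words_def)

lemma sublist_pair_Cons:
  "sublist [x, y] (z # w) \<longleftrightarrow> x = z \<and> (\<exists>w'. w = y # w') \<or> sublist [x, y] w"
  by (auto simp: sublist_Cons_right prefix_def)

lemma sublist_pair_append:
  "sublist [x, y] (u @ v) \<longleftrightarrow>
    sublist [x, y] u \<or> sublist [x, y] v \<or> (\<exists>u' v'. u = u' @ [x] \<and> v = y # v')"
proof (induction u)
  case (Cons z u)
  then show ?case
    by (cases u) (auto simp: sublist_pair_Cons Cons_eq_append_conv)
qed auto

lemma X_Cons_in_RB_words_iff:
  "X # w \<in> RB_words \<longleftrightarrow> w \<in> RB_words \<and> \<not> (\<exists>w'. w = X # w')"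
  by (auto simp: RB_words_iff sublist_Cons_right enclose_def prefix_Cons prefix_def)

text \<open>
  A bracketed factor of \<open>[v]u\<close>, where \<open>[v]\<close> stands for \<open>enclose v\<close>, cannot straddle a seam.
  If it began inside \<open>[v]\<close> and ended in \<open>u\<close>, its first part would be a proper prefix of a bracketed word, hence of positive excess,
  but also a suffix of a balanced word, hence of excess at most \<open>0\<close>. If it shared only one end
  with \<open>[v]\<close>, a proper prefix of \<open>[v]\<close> would have excess \<open>0\<close>.
\<close>

lemma enclose_sublist_enclose_append:
  assumes "balanced v" "balanced v'" "sublist (enclose v') (enclose v @ u)"
  shows "v' = v \<or> sublist (enclose v') v \<or> sublist (enclose v') u"
proof -
  have excess: "excess (enclose v) = 0" "excess (enclose v') = 0"
    using assms by (simp_all add: balanced_excess)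
  from assms(3) consider "sublist (enclose v') (enclose v)" | "sublist (enclose v') u"
    | s1 s2 where "enclose v' = s1 @ s2" "suffix s1 (enclose v)" "s1 \<noteq> []" "s2 \<noteq> []"
    by (auto simp: sublist_append)
      (metis append_Nil append_Nil2 prefix_imp_sublist suffix_imp_sublist)
  then show ?thesis
  proof cases
    case 1
    then obtain p q where pq: "enclose v = p @ enclose v' @ q"
      by (auto simp: sublist_def)
    then have "excess p + excess q = 0"
      using excess by simp
    have "0 < excess p" if "p \<noteq> []"
      using enclose_proper_prefix_excess[OF assms(1) pq] that by simp
    moreover have "0 < excess (p @ enclose v')" if "q \<noteq> []"
      using enclose_proper_prefix_excess[OF assms(1), of "p @ enclose v'" q] pq that by simp
    ultimately consider "p = []" "q = []" | "p \<noteq> []" "q \<noteq> []"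
      using \<open>excess p + excess q = 0\<close> excess by fastforce
    then show ?thesis
    proof cases
      case 1
      with pq show ?thesis
        by simp
    next
      case 2
      obtain l p' where p: "p = l # p'"
        using 2(1) by (cases p) auto
      obtain l' q' where q: "q = q' @ [l']"
        using 2(2) by (cases q rule: rev_cases) auto
      have "v = p' @ enclose v' @ q'"
        using pq unfolding p q enclose_def[of v] by simp
      then show ?thesis
        by simp
    qed
  next
    case 3
    then have "excess s1 \<le> 0"
      using balanced_suffix_excess[of _ s1] balanced_enclose[OF assms(1)]
      by (auto simp: suffix_def)
    with enclose_proper_prefix_excess[OF assms(2) 3(1,3,4)] show ?thesis
      by simp
  qed simp
qed

lemma sublist_pair_enclose_append:
  "sublist [x, y] (enclose v @ u) \<longleftrightarrow> sublist [x, y] v \<or> sublist [x, y] u \<or>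
    x = LB \<and> (\<exists>w. v @ RB # u = y # w) \<or> (\<exists>v'. v = v' @ [x]) \<and> y = RB \<or>
    x = RB \<and> (\<exists>u'. u = y # u')"
  by (simp add: enclose_def sublist_pair_Cons sublist_pair_append) blast

text \<open>
  At the three seams of \<open>[v]u\<close> the following new patterns can arise: \<open>LB RB\<close> when \<open>v\<close> is
  empty, \<open>RB LB\<close> when \<open>u\<close> starts with a bracket, and an immediate nesting when \<open>v\<close> is itself
  bracketed. Nothing else is possible because a balanced word does not start with \<open>RB\<close> or end
  with \<open>LB\<close>.
\<close>

lemma enclose_append_in_RB_words_iff:
  assumes "balanced v" "balanced u"
  shows "enclose v @ u \<in> RB_words \<longleftrightarrow>
    v \<in> RB_words \<and> v \<noteq> [] \<and> v \<notin> enclose ` Collect balanced \<and>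
    u \<in> RB_words \<and> (\<forall>u'. u \<noteq> LB # u')"
proof -
  have ends: "v \<noteq> v' @ [LB]" "v \<noteq> RB # v'" "u \<noteq> RB # v'" for v'
    using assms by auto
  have pairs: "sublist [X, X] (enclose v @ u) \<longleftrightarrow> sublist [X, X] v \<or> sublist [X, X] u"
    "sublist [RB, LB] (enclose v @ u) \<longleftrightarrow>
      sublist [RB, LB] v \<or> sublist [RB, LB] u \<or> (\<exists>u'. u = LB # u')"
    "sublist [LB, RB] (enclose v @ u) \<longleftrightarrow> sublist [LB, RB] v \<or> sublist [LB, RB] u \<or> v = []"
    by (simp_all add: sublist_pair_enclose_append append_eq_Cons_conv ends)
  have "(\<exists>v'. balanced v' \<and> sublist (enclose (enclose v')) (enclose v @ u)) \<longleftrightarrow>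
    (\<exists>v'. balanced v' \<and> sublist (enclose (enclose v')) v) \<or>
    (\<exists>v'. balanced v' \<and> sublist (enclose (enclose v')) u) \<or> v \<in> enclose ` Collect balanced"
    (is "?L \<longleftrightarrow> ?R")
  proof
    assume ?L
    then obtain v' where v': "balanced v'" "sublist (enclose (enclose v')) (enclose v @ u)"
      by blast
    then have "enclose v' = v \<or> sublist (enclose (enclose v')) v \<or>
        sublist (enclose (enclose v')) u"
      by (intro enclose_sublist_enclose_append assms balanced_enclose)
    with v'(1) show ?R
      by blast
  next
    have "sublist v (enclose v @ u)"
      using sublist_appendI[of v "[LB]" "RB # u"] by (simp add: enclose_def)
    moreover have "sublist u (enclose v @ u)" "sublist (enclose v) (enclose v @ u)"
      by simp_all
    moreover assume ?R
    ultimately show ?L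
      using sublist_order.order_trans by blast
  qed
  with pairs assms show ?thesis
    unfolding RB_words_iff by (auto simp: balanced_append)
qed

definition nonX_words :: "word set" where
  "nonX_words = {w \<in> RB_words. \<forall>w'. w \<noteq> X # w'}"

text \<open>
  The admissible contents of a pair of brackets.
\<close>

definition core_words :: "word set" where
  "core_words = {w \<in> RB_words. w \<noteq> [] \<and> w \<notin> enclose ` Collect balanced}"

lemma RB_words_balanced: "w \<in> RB_words \<Longrightarrow> balanced w"
  by (simp add: RB_words_iff)

lemma core_words_balanced: "w \<in> core_words \<Longrightarrow> balanced w"
  by (simp add: core_words_def RB_words_balanced)

lemma nonX_words_balanced: "w \<in> nonX_words \<Longrightarrow> balanced w"
  by (simp add: nonX_words_def RB_words_balanced)

lemma RB_words_split_leading_X: "RB_words = nonX_words \<union> (#) X ` nonX_words"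
  by (auto simp: nonX_words_def X_Cons_in_RB_words_iff)

lemma RB_words_split_enclosed: "RB_words = insert [] (core_words \<union> enclose ` core_words)"
proof -
  have "enclose v \<in> RB_words \<longleftrightarrow> v \<in> core_words" if "balanced v" for v
    using enclose_append_in_RB_words_iff[OF that, of "[]"] by (simp add: core_words_def)
  then show ?thesis
    by (auto simp: core_words_def dest: RB_words_balanced)
qed

lemma nonX_words_split_bracket:
  "nonX_words = insert [] ((\<lambda>(b, u). b @ u) `
    (enclose ` core_words \<times> insert [] ((#) X ` nonX_words)))" (is "_ = ?N")
proof
  show "nonX_words \<subseteq> ?N"
  proof
    fix w assume w: "w \<in> nonX_words"
    then have "balanced w"
      by (rule nonX_words_balanced)
    show "w \<in> ?N"
    proof (cases w)
      case (Cons l w')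
      with w \<open>balanced w\<close> have "l = LB"
        by (cases l) (auto simp: nonX_words_def)
      with Cons \<open>balanced w\<close> obtain v u where vu: "balanced v" "balanced u" "w = enclose v @ u"
        using balanced_Cons_LB by metis
      with w have v: "v \<in> core_words" and u: "u \<in> RB_words" "\<forall>u'. u \<noteq> LB # u'"
        using enclose_append_in_RB_words_iff[of v u]
        by (auto simp: nonX_words_def core_words_def)
      have "u \<in> insert [] ((#) X ` nonX_words)"
      proof (cases u)
        case (Cons l u')
        with u vu(2) show ?thesis
          by (cases l) (auto simp: nonX_words_def X_Cons_in_RB_words_iff)
      qed simp
      with v vu(3) show ?thesis
        by force
    qed simp
  qed
  show "?N \<subseteq> nonX_words"
  proof
    fix w assume "w \<in> ?N"
    then consider "w = []"
      | v u where "v \<in> core_words" "u \<in> insert [] ((#) X ` nonX_words)" "w = enclose v @ u"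
      by auto
    then show "w \<in> nonX_words"
    proof cases
      case 2
      have "u \<in> RB_words" "\<forall>u'. u \<noteq> LB # u'"
        using 2(2) RB_words_split_leading_X by auto
      with 2 have "w \<in> RB_words"
        using enclose_append_in_RB_words_iff[of v u]
        by (auto simp: core_words_def RB_words_balanced)
      with 2(3) show ?thesis
        by (simp add: nonX_words_def enclose_def)
    qed (simp add: nonX_words_def)
  qed
qed

section \<open>Generating functions of sets of words\<close>

text \<open>
  The weight counts \<open>LB\<close> instead of matched pairs so that it is additive on all words;
  the two agree on balanced words by \<open>degree_word_balanced\<close>.
\<close>

definition words_with :: "word set \<Rightarrow> nat \<Rightarrow> nat \<Rightarrow> word set" where
  "words_with S n m = {w \<in> S. count_list w LB = n \<and> count_list w X = m}"

definition gf :: "word set \<Rightarrow> rat fps2" where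
  "gf S = Abs_fps (\<lambda>n. Abs_fps (\<lambda>m. of_nat (card (words_with S n m))))"

lemma gf_nth [simp]: "fps_nth (fps_nth (gf S) n) m = of_nat (card (words_with S n m))"
  by (simp add: gf_def)

lemma length_balanced:
  assumes "balanced w"
  shows "length w = 2 * count_list w LB + count_list w X"
proof -
  have "length w = count_list w LB + count_list w RB + count_list w X"
  proof (induction w)
    case (Cons l w)
    then show ?case by (cases l) auto
  qed simp
  with assms show ?thesis
    by (simp add: balanced_def)
qed

lemma UNIV_letter: "UNIV = {X, LB, RB}"
  using letter.exhaust by auto

text \<open>
  Balance fixes the number of \<open>RB\<close>, so that degree and arity bound the length. Without
  finiteness \<open>card\<close> would not be additive.
\<close>

lemma finite_words_with:
  assumes "S \<subseteq> Collect balanced"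
  shows "finite (words_with S n m)"
proof (rule finite_subset)
  show "words_with S n m \<subseteq> {w. set w \<subseteq> UNIV \<and> length w = 2 * n + m}"
    using assms by (auto simp: words_with_def dest: length_balanced)
  show "finite {w :: word. set w \<subseteq> UNIV \<and> length w = 2 * n + m}"
    by (rule finite_lists_length_eq) (simp add: UNIV_letter)
qed

lemma gf_Un:
  assumes "S \<subseteq> Collect balanced" "T \<subseteq> Collect balanced" "S \<inter> T = {}"
  shows "gf (S \<union> T) = gf S + gf T"
proof -
  have "card (words_with (S \<union> T) n m) = card (words_with S n m) + card (words_with T n m)" for n m
  proof -
    have "words_with (S \<union> T) n m = words_with S n m \<union> words_with T n m"
      by (auto simp: words_with_def)
    moreover have "words_with S n m \<inter> words_with T n m = {}"
      using assms(3) by (auto simp: words_with_def)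
    ultimately show ?thesis
      using assms by (simp add: card_Un_disjoint finite_words_with)
  qed
  then show ?thesis
    by (simp add: fps_eq_iff)
qed

lemma gf_Nil: "gf {[]} = 1"
proof -
  have "words_with {[]} n m = (if n = 0 \<and> m = 0 then {[]} else {})" for n m
    by (auto simp: words_with_def)
  then show ?thesis
    by (simp add: fps_eq_iff)
qed

lemma gf_insert_Nil:
  assumes "S \<subseteq> Collect balanced" "[] \<notin> S"
  shows "gf (insert [] S) = 1 + gf S"
  using gf_Un[of "{[]}" S] assms by (simp add: gf_Nil)

lemma gf_Cons_X: "gf ((#) X ` S) = var_t * gf S"
proof -
  have "words_with ((#) X ` S) n m = (if m = 0 then {} else (#) X ` words_with S n (m - 1))" for n m
    by (cases m) (auto simp: words_with_def)
  moreover have "card ((#) X ` A) = card A" for A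
    by (rule card_image) simp
  ultimately show ?thesis
    by (simp add: fps_eq_iff var_t_def)
qed

lemma gf_enclose: "gf (enclose ` S) = var_z * gf S"
proof -
  have "words_with (enclose ` S) n m =
      (if n = 0 then {} else enclose ` words_with S (n - 1) m)" for n m
    by (cases n) (auto simp: words_with_def enclose_def)
  moreover have "card (enclose ` A) = card A" for A
    by (rule card_image) (simp add: inj_on_def)
  ultimately show ?thesis
    by (simp add: fps_eq_iff var_z_def)
qed

text \<open>
  Unique factorisation makes concatenation a bijection, and the coefficients of the Cauchy
  product count the pairs according to how degree and arity are shared between the factors.
\<close>

lemma gf_append:
  assumes "S \<subseteq> Collect balanced" "T \<subseteq> Collect balanced"
    and inj: "inj_on (\<lambda>(u, v). u @ v) (S \<times> T)"
  shows "gf ((\<lambda>(u, v). u @ v) ` (S \<times> T)) = gf S * gf T"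
proof -
  let ?cat = "\<lambda>(u :: word, v). u @ v"
  have "card (words_with (?cat ` (S \<times> T)) n m) =
    (\<Sum>i\<le>n. \<Sum>j\<le>m. card (words_with S i j) * card (words_with T (n - i) (m - j)))" for n m
  proof -
    let ?P = "\<lambda>(i, j). words_with S i j \<times> words_with T (n - i) (m - j)"
    have "words_with (?cat ` (S \<times> T)) n m = ?cat ` (\<Union>ij\<in>{..n} \<times> {..m}. ?P ij)"
      by (force simp: words_with_def image_iff)
    moreover have "inj_on ?cat (\<Union>ij\<in>{..n} \<times> {..m}. ?P ij)"
      by (rule inj_on_subset[OF inj]) (auto simp: words_with_def)
    ultimately have "card (words_with (?cat ` (S \<times> T)) n m) =
        card (\<Union>ij\<in>{..n} \<times> {..m}. ?P ij)"
      by (simp add: card_image)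
    also have "\<dots> = (\<Sum>ij\<in>{..n} \<times> {..m}. card (?P ij))"
      by (rule card_UN_disjoint)
        (use assms in \<open>auto simp: finite_words_with\<close>, auto simp: words_with_def)
    also have "\<dots> = (\<Sum>i\<le>n. \<Sum>j\<le>m. card (words_with S i j) * card (words_with T (n - i) (m - j)))"
      by (simp add: sum.cartesian_product case_prod_unfold card_cartesian_product)
    finally show ?thesis .
  qed
  then show ?thesis
    by (simp add: fps_eq_iff fps_mult_nth fps_sum_nth atLeast0AtMost)
qed

section \<open>The functional equation\<close>

lemma gf_RB_words_leading_X: "gf RB_words = (1 + var_t) * gf nonX_words"
proof -
  have "gf RB_words = gf nonX_words + gf ((#) X ` nonX_words)"
    by (subst RB_words_split_leading_X, rule gf_Un)
      (auto simp: nonX_words_balanced, auto simp: nonX_words_def)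
  then show ?thesis
    by (simp add: gf_Cons_X algebra_simps)
qed

lemma gf_RB_words_enclosed: "gf RB_words = 1 + (1 + var_z) * gf core_words"
proof -
  have "gf RB_words = 1 + gf (core_words \<union> enclose ` core_words)"
    by (subst RB_words_split_enclosed, rule gf_insert_Nil)
      (auto simp: core_words_balanced, auto simp: core_words_def)
  also have "gf (core_words \<union> enclose ` core_words) = gf core_words + gf (enclose ` core_words)"
    by (rule gf_Un) (auto simp: core_words_balanced, auto simp: core_words_def RB_words_balanced)
  finally show ?thesis
    by (simp add: gf_enclose algebra_simps)
qed

lemma gf_nonX_words: "gf nonX_words = 1 + var_z * gf core_words * (1 + var_t * gf nonX_words)"
proof -
  let ?U = "insert [] ((#) X ` nonX_words)"
  let ?W = "(\<lambda>(b, u). b @ u) ` (enclose ` core_words \<times> ?U)"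
  have U: "?U \<subseteq> Collect balanced"
    by (auto simp: nonX_words_balanced)
  have E: "enclose ` core_words \<subseteq> Collect balanced"
    by (auto simp: core_words_balanced)
  have "gf nonX_words = 1 + gf ?W"
    by (subst nonX_words_split_bracket, rule gf_insert_Nil)
      (use U E in \<open>auto intro!: balanced_append simp: core_words_balanced nonX_words_balanced\<close>)
  also have "gf ?W = gf (enclose ` core_words) * gf ?U"
  proof (rule gf_append[OF E U], rule inj_onI, clarify)
    fix v u v' u'
    assume "v \<in> core_words" "v' \<in> core_words" "enclose v @ u = enclose v' @ u'"
    then show "enclose v = enclose v' \<and> u = u'"
      using enclose_append_inject[of v v' u u'] by (simp add: core_words_balanced)
  qed
  also have "gf ?U = 1 + gf ((#) X ` nonX_words)"
    by (rule gf_insert_Nil) (auto simp: nonX_words_balanced)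
  finally show ?thesis
    by (simp add: gf_enclose gf_Cons_X)
qed

lemma rb_series_eq_gf: "rb_series = gf RB_words"
proof -
  have "{w \<in> RB_words. degree_word w = n \<and> arity w = m} = words_with RB_words n m" for n m
    by (auto simp: words_with_def arity_def degree_word_balanced RB_words_balanced)
  then show ?thesis
    by (simp add: rb_series_def gf_def r_def)
qed

text \<open>
  Multiplying the equation for \<open>Q\<close> by \<open>1 + z\<close> lets the two expressions for \<open>R\<close> eliminate \<open>C\<close>
  without a division.
\<close>

lemma quadratic_of_grammar_equations:
  fixes z t R Q C :: "'a :: idom"
  assumes R: "R = (1 + t) * Q" "R = 1 + (1 + z) * C" and Q: "Q = 1 + z * C * (1 + t * Q)"
  shows "t * z * R ^ 2 = R - 1 - t"
proof -
  have C: "(1 + z) * C = (1 + t) * Q - 1"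
    using R by algebra
  have "Q - 1 = z * t * (1 + t) * Q ^ 2"
    using C Q by algebra
  with R(1) show ?thesis
    by algebra
qed

lemma rb_series_functional_equation:
  "var_t * var_z * rb_series ^ 2 = rb_series - 1 - var_t"
  unfolding rb_series_eq_gf
  by (rule quadratic_of_grammar_equations[OF gf_RB_words_leading_X gf_RB_words_enclosed
        gf_nonX_words])

theorem theorem3p3:
  shows "to_fract rb_series =
    (1 - to_fract (fps2_sqrt (1 - 4 * var_z * var_t - 4 * var_z * var_t ^ 2))) /
    to_fract (2 * var_t * var_z)"
proof -
  define S where "S = 1 - 2 * var_t * var_z * rb_series"
  have "S ^ 2 = 1 - 4 * var_t * var_z * (rb_series - var_t * var_z * rb_series ^ 2)"
    by (simp add: S_def algebra_simps power2_eq_square)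
  also have "\<dots> = 1 - 4 * var_z * var_t - 4 * var_z * var_t ^ 2"
    unfolding rb_series_functional_equation by (simp add: algebra_simps power2_eq_square)
  finally have "S ^ 2 = 1 - 4 * var_z * var_t - 4 * var_z * var_t ^ 2" .
  moreover have "fps_nth (fps_nth S 0) 0 = 1"
    by (simp add: S_def var_z_def)
  ultimately have sqrt: "fps2_sqrt (1 - 4 * var_z * var_t - 4 * var_z * var_t ^ 2) = S"
    by (rule fps2_sqrt_eqI)
  have "2 * var_t * var_z \<noteq> 0"
    by (simp add: var_t_def var_z_def)
  then have "to_fract (2 * var_t * var_z) \<noteq> 0"
    by (simp only: to_fract_eq_0_iff not_False_eq_True)
  moreover have "1 - to_fract S = to_fract rb_series * to_fract (2 * var_t * var_z)"
    unfolding S_def by (simp add: mult_ac)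
  ultimately show ?thesis
    unfolding sqrt by (simp only: nonzero_mult_div_cancel_right not_False_eq_True)
qed

end
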